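(* Let $G$ be an $r$-regular simple mixed graph on $n$ vertices, with $\mathcal{I}$-eigenvalues $\boldsymbol{\lambda}_1(G)\ge\cdots\ge\boldsymbol{\lambda}_{2n}(G)$. If $G'$ is an induced submixed graph of $G$ with $n'<n$ vertices, then $$\boldsymbol{\lambda}_{2n}(G)\le\frac{nd'-rn'}{n-n'}\le\boldsymbol{\lambda}_2(G),$$ where $d'=\frac{1}{2n'}\sum_{u\in V_{G'}}\left[2d(u)+d^+(u)+d^-(u)\right]$, the degrees $d(u),d^+(u),d^-(u)$ being taken in $G'$.
   Context: A mixed graph $G$ has a finite nonempty vertex set $V_G=\{v_1,\dots,v_n\}$, a finite set $E_G$ of (undirected) edges, each joining an unordered pair of vertices $\{u,v\}$ (a loop if $u=v$), and a finite set $\vec E_G$ of arcs, each going from $u$ to $v$ for an ordered pair $(u,v)$ of vertices (a directed loop if $u=v$); multiple edges, loops, arcs and directed loops are allowed. $G$ is simple if it has no loops, no directed loops, at most one edge joining any two vertices, and at most one arc from $u$ to $v$ for each ordered pair $(u,v)$ (an edge and arcs in both directions may coexist on the same pair of vertices). The integrated adjacency matrix $\mathcal{I}(G)$ is the real symmetric $2n\times 2n$ matrix $\begin{bmatrix}A&D\\ D^T&A\end{bmatrix}$, where $A_{ij}$ ($i\neq j$) is the number of edges joining $v_i$ and $v_j$, $A_{ii}$ is twice the number of loops at $v_i$, and $D_{ij}$ is the number of arcs from $v_i$ to $v_j$. Its eigenvalues, counted with multiplicity, are the $\mathcal{I}$-eigenvalues of $G$. Degrees: $d(u)$ is the number of edges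 incident with $u$ (loops counted twice), $d^+(u)$ the number of arcs starting at $u$, $d^-(u)$ the number of arcs ending at $u$. $G$ is $r$-regular if $d^+(u)=d^-(u)$ and $d(u)+d^+(u)=r$ for all $u\in V_G$. An induced submixed graph of $G$ on a nonempty vertex subset contains all edges and arcs of $G$ with both ends in that subset. *)

theory Defs
  imports "Jordan_Normal_Form.Char_Poly"
begin

text \<open>
  Edges and arcs are abstract names, so that multiple edges and arcs are possible.
  The unordered pair joined by an edge is its set of ends, a singleton exactly for a loop.
\<close>

record ('a, 'e, 'b) mgraph =
  verts :: "'a set"
  edges :: "'e set"
  ends :: "'e \<Rightarrow> 'a set"
  arcs :: "'b set"
  tail :: "'b \<Rightarrow> 'a"
  head :: "'b \<Rightarrow> 'a"

locale mixed_graph =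
  fixes G :: "('a, 'e, 'b) mgraph"
  assumes finite_verts: "finite (verts G)"
    and verts_nonempty: "verts G \<noteq> {}"
    and finite_edges: "finite (edges G)"
    and ends_in_verts: "e \<in> edges G \<Longrightarrow> \<exists>u\<in>verts G. \<exists>v\<in>verts G. ends G e = {u, v}"
    and finite_arcs: "finite (arcs G)"
    and tail_in_verts: "a \<in> arcs G \<Longrightarrow> tail G a \<in> verts G"
    and head_in_verts: "a \<in> arcs G \<Longrightarrow> head G a \<in> verts G"

locale simple_mixed_graph = mixed_graph +
  assumes no_loops: "e \<in> edges G \<Longrightarrow> ends G e \<noteq> {u}"
    and no_directed_loops: "a \<in> arcs G \<Longrightarrow> tail G a \<noteq> head G a"
    and no_multi_edges: "\<lbrakk>e \<in> edges G; e' \<in> edges G; ends G e = ends G e'\<rbrakk> \<Longrightarrow> e = e'"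
    and no_multi_arcs:
      "\<lbrakk>a \<in> arcs G; a' \<in> arcs G; tail G a = tail G a'; head G a = head G a'\<rbrakk> \<Longrightarrow> a = a'"

text \<open>The second summand makes every loop count twice.\<close>

definition edge_degree :: "('a, 'e, 'b) mgraph \<Rightarrow> 'a \<Rightarrow> nat" where
  "edge_degree G u = card {e \<in> edges G. u \<in> ends G e} + card {e \<in> edges G. ends G e = {u}}"

definition out_degree :: "('a, 'e, 'b) mgraph \<Rightarrow> 'a \<Rightarrow> nat" where
  "out_degree G u = card {a \<in> arcs G. tail G a = u}"

definition in_degree :: "('a, 'e, 'b) mgraph \<Rightarrow> 'a \<Rightarrow> nat" where
  "in_degree G u = card {a \<in> arcs G. head G a = u}"

definition regular :: "nat \<Rightarrow> ('a, 'e, 'b) mgraph \<Rightarrow> bool" where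
  "regular r G \<longleftrightarrow>
     (\<forall>u\<in>verts G. out_degree G u = in_degree G u \<and> edge_degree G u + out_degree G u = r)"

definition induce :: "('a, 'e, 'b) mgraph \<Rightarrow> 'a set \<Rightarrow> ('a, 'e, 'b) mgraph" where
  "induce G W =
     \<lparr>verts = W, edges = {e \<in> edges G. ends G e \<subseteq> W}, ends = ends G,
      arcs = {a \<in> arcs G. tail G a \<in> W \<and> head G a \<in> W}, tail = tail G, head = head G\<rparr>"

definition induced_submixed_graph ::
    "('a, 'e, 'b) mgraph \<Rightarrow> ('a, 'e, 'b) mgraph \<Rightarrow> bool" where
  "induced_submixed_graph G' G \<longleftrightarrow> (\<exists>W. W \<noteq> {} \<and> W \<subseteq> verts G \<and> G' = induce G W)"

definition edge_count :: "('a, 'e, 'b) mgraph \<Rightarrow> 'a \<Rightarrow> 'a \<Rightarrow> nat" where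
  "edge_count G u v =
     (if u = v then 2 * card {e \<in> edges G. ends G e = {u}}
      else card {e \<in> edges G. ends G e = {u, v}})"

definition arc_count :: "('a, 'e, 'b) mgraph \<Rightarrow> 'a \<Rightarrow> 'a \<Rightarrow> nat" where
  "arc_count G u v = card {a \<in> arcs G. tail G a = u \<and> head G a = v}"

text \<open>The list \<open>vs\<close> is an enumeration of the vertices, each occurring once.\<close>

definition integrated_adjacency_matrix :: "('a, 'e, 'b) mgraph \<Rightarrow> 'a list \<Rightarrow> real mat" where
  "integrated_adjacency_matrix G vs =
     (let n = length vs;
          A = mat n n (\<lambda>(i, j). real (edge_count G (vs ! i) (vs ! j)));
          D = mat n n (\<lambda>(i, j). real (arc_count G (vs ! i) (vs ! j)))
      in four_block_mat A D (transpose_mat D) A)"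

text \<open>
  The real roots of the characteristic polynomial in decreasing order, repeated according
  to multiplicity. For a symmetric matrix, these are all its eigenvalues, so the list has
  as many entries as the matrix has rows.
\<close>

definition eigenvalue_list :: "real mat \<Rightarrow> real list" where
  "eigenvalue_list M = rev (sorted_list_of_multiset (proots (char_poly M)))"

text \<open>The index \<open>k\<close> starts at 1.\<close>

definition I_eigenvalue :: "('a, 'e, 'b) mgraph \<Rightarrow> 'a list \<Rightarrow> nat \<Rightarrow> real" where
  "I_eigenvalue G vs k = eigenvalue_list (integrated_adjacency_matrix G vs) ! (k - 1)"

end

theory Submission
  imports Defs "Jordan_Normal_Form.Schur_Decomposition"
begin

text \<open>
  Let \<open>M\<close> be the integrated adjacency matrix of \<open>G\<close>, of size \<open>2n\<close>. Regularity means that every row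
  of \<open>M\<close> sums to \<open>r\<close>, so the all-one vector \<open>j\<close> is an eigenvector for \<open>r\<close>
  (\<open>regular_integrated_row_sum\<close>). Let \<open>x\<close> be the \<open>0\<close>-\<open>1\<close> vector that selects the vertices of \<open>G'\<close>
  in both halves of the index set. Then \<open>x \<bullet> x = 2n'\<close>, and \<open>x \<bullet> M x = 2n'd'\<close> because this number adds
  up the degrees in \<open>G'\<close> (\<open>induced_quadratic_form\<close>). Let \<open>y = x - (n'/n) j\<close> be the projection of \<open>x\<close> to
  the complement of \<open>j\<close>. A short computation shows that its Rayleigh quotient is
  \<open>\<rho> = (nd' - rn')/(n - n')\<close>, the number in the theorem.

  As a Rayleigh quotient, \<open>\<rho>\<close> is at least the smallest eigenvalue
  (\<open>least_eigenvalue_le_rayleigh\<close>). For the other bound, the average degree \<open>d'\<close> is at most \<open>r\<close>, since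
  degrees in \<open>G'\<close> do not exceed those in \<open>G\<close>; hence \<open>\<rho> \<le> r\<close>. The vectors \<open>j\<close> and \<open>y\<close> are orthogonal, and
  \<open>j \<bullet> M y = 0\<close>, so the Rayleigh quotient is at least \<open>min r \<rho> = \<rho>\<close> on the whole plane that they
  span. That plane meets the complement of the first eigenvector, where the Rayleigh quotient is
  at most the second eigenvalue (\<open>quadratic_form_le_second_eigenvalue\<close>). The lemma
  \<open>constant_row_sum_rayleigh\<close> combines both bounds for any symmetric matrix with constant row sum.

  The Rayleigh bounds refer to the decreasing list of real roots of the characteristic polynomial.
  They rest on the spectral theorem: this polynomial splits over the reals
  (\<open>symmetric_char_poly_splits\<close>), and \<open>M\<close> has an orthonormal eigenbasis in the order of that list
  (\<open>symmetric_orthogonal_diagonalisation\<close>).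
\<close>

section \<open>The spectral theorem for real symmetric matrices\<close>

text \<open>
  Gram--Schmidt applied to a basis that begins with \<open>v\<close> leaves \<open>v\<close> unchanged and gives
  pairwise orthogonal vectors; dividing each by its length gives an orthogonal matrix.
\<close>

lemma orthogonal_matrix_with_first_column:
  fixes v :: "real vec"
  assumes v: "v \<in> carrier_vec n" and v0: "v \<noteq> 0\<^sub>v n"
  obtains W c where "W \<in> carrier_mat n n" "transpose_mat W * W = 1\<^sub>m n" "col W 0 = c \<cdot>\<^sub>v v"
proof -
  have n: "0 < n" using v v0 by (cases n) auto
  interpret cof_vec_space n "TYPE(real)" .
  define b where "b = basis_completion v"
  define ws where "ws = gram_schmidt n b"
  have b: "distinct b" "\<not> lin_dep (set b)" "set b \<subseteq> carrier_vec n" "hd b = v" "length b = n"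
    using basis_completion[OF v v0] unfolding b_def by auto
  then obtain vs where bv: "b = v # vs" using n by (cases b) auto
  from gram_schmidt_result[OF b(3,1,2) refl]
  have ws: "set ws \<subseteq> carrier_vec n" "corthogonal ws" "length ws = n"
    unfolding ws_def by (auto simp: b(5))
  have hd_ws: "ws ! 0 = v"
    using gram_schmidt_hd[OF v, of vs] ws(3) n
    unfolding bv[symmetric] ws_def[symmetric] by (cases ws) auto
  have wsi: "ws ! i \<in> carrier_vec n" if "i < n" for i using ws that by auto
  have orth: "ws ! i \<bullet> ws ! j = 0 \<longleftrightarrow> i \<noteq> j" if "i < n" "j < n" for i j
    using corthogonalD[OF ws(2)] that ws(3) by simp
  have pos: "0 < ws ! i \<bullet> ws ! i" if "i < n" for i
    using orth[OF that that] conjugate_square_ge_0_vec[of "ws ! i"] by simp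
  define c where "c i = 1 / sqrt (ws ! i \<bullet> ws ! i)" for i
  define W where "W = mat_of_cols n (map (\<lambda>i. c i \<cdot>\<^sub>v ws ! i) [0..<n])"
  have W: "W \<in> carrier_mat n n" unfolding W_def by auto
  have colW: "col W i = c i \<cdot>\<^sub>v ws ! i" if "i < n" for i
    using that wsi[OF that] unfolding W_def by simp
  have "transpose_mat W * W = 1\<^sub>m n"
  proof (rule eq_matI)
    fix i j assume "i < dim_row (1\<^sub>m n :: real mat)" "j < dim_col (1\<^sub>m n :: real mat)"
    hence ij: "i < n" "j < n" by auto
    have "(transpose_mat W * W) $$ (i, j) = col W i \<bullet> col W j" using W ij by auto
    also have "\<dots> = c i * c j * (ws ! i \<bullet> ws ! j)"
      unfolding colW[OF ij(1)] colW[OF ij(2)] using wsi[OF ij(1)] wsi[OF ij(2)] by simp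
    also have "\<dots> = 1\<^sub>m n $$ (i, j)"
      using ij orth[OF ij] pos[OF ij(1)] by (auto simp: c_def)
    finally show "(transpose_mat W * W) $$ (i, j) = 1\<^sub>m n $$ (i, j)" .
  qed (use W in auto)
  with W colW[OF n] hd_ws that show ?thesis by metis
qed

text \<open>
  The order of the diagonal entries is that of the given list of roots, so that it can later be
  chosen decreasing. The proof is the deflation step of the Schur decomposition: an orthogonal
  change of basis that begins with an eigenvector for \<open>e\<close> clears the first column except for \<open>e\<close>.
  Since orthogonal changes of basis preserve symmetry, the first row is cleared too, and the
  remaining block is symmetric of smaller size, with the remaining roots.
\<close>

lemma symmetric_orthogonal_diagonalisation:
  fixes A :: "real mat"
  assumes "A \<in> carrier_mat n n" and "transpose_mat A = A"
    and "char_poly A = (\<Prod>e\<leftarrow>es. [:- e, 1:])"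
  shows "\<exists>U \<in> carrier_mat n n. transpose_mat U * U = 1\<^sub>m n \<and>
           transpose_mat U * A * U = mat_diag n (\<lambda>i. es ! i)"
  using assms
proof (induction es arbitrary: n A)
  case Nil
  with degree_monic_char_poly[of A n] have "n = 0" by simp
  with Nil.prems show ?case by (intro bexI[of _ "1\<^sub>m 0"]) (auto intro!: eq_matI simp: mat_diag_def)
next
  case (Cons e es n A)
  note A = Cons.prems(1) and sym = Cons.prems(2)
  from Cons.prems(3)
  have cp: "char_poly A = [: -e, 1 :] * (\<Prod>e \<leftarrow> es. [:- e, 1:])" by simp
  have mon: "monic (\<Prod>e\<leftarrow> es. [:- e, 1:])" by (rule monic_prod_list) auto
  have "degree (char_poly A) = Suc (degree (\<Prod>e\<leftarrow> es. [:- e, 1:]))" unfolding cp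
    by (subst degree_mult_eq, insert mon, auto)
  with degree_monic_char_poly[OF A] obtain m where n: "n = Suc m" by (cases n) auto
  have "eigenvalue A e" unfolding eigenvalue_root_char_poly[OF A] cp by simp
  then obtain v where v: "v \<in> carrier_vec n" "v \<noteq> 0\<^sub>v n" and Av: "A *\<^sub>v v = e \<cdot>\<^sub>v v"
    using A unfolding eigenvalue_def eigenvector_def by auto
  obtain W c where W: "W \<in> carrier_mat n n" and WW: "transpose_mat W * W = 1\<^sub>m n"
    and W0: "col W 0 = c \<cdot>\<^sub>v v"
    using orthogonal_matrix_with_first_column[OF v] .
  have WT: "transpose_mat W \<in> carrier_mat n n" using W by simp
  have WW': "W * transpose_mat W = 1\<^sub>m n" by (rule mat_mult_left_right_inverse[OF WT W WW])
  define C where "C = transpose_mat W * A * W"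
  have C: "C \<in> carrier_mat n n" unfolding C_def using W A by auto
  have symC: "transpose_mat C = C"
    unfolding C_def using W A WT sym
    by (simp add: transpose_mult[of _ n n _ n] assoc_mult_mat[of _ n n _ n _ n])
  have C_sym: "C $$ (i, j) = C $$ (j, i)" if "i < n" "j < n" for i j
    using arg_cong[OF symC, of "\<lambda>M. M $$ (i, j)"] C that by simp
  have C0: "C $$ (i, 0) = (if i = 0 then e else 0)" if i: "i < n" for i
  proof -
    have "C $$ (i, 0) = (transpose_mat W * (A * W)) $$ (i, 0)"
      unfolding C_def using W A WT by (simp add: assoc_mult_mat[of _ n n _ n _ n])
    also have "\<dots> = col W i \<bullet> col (A * W) 0" using W A i n by simp
    also have "col (A * W) 0 = A *\<^sub>v col W 0" using W A n by (intro col_mult2) auto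
    also have "\<dots> = e \<cdot>\<^sub>v col W 0" unfolding W0
      using A v(1) Av by (simp add: mult_mat_vec[OF A v(1)] smult_smult_assoc mult.commute)
    also have "col W i \<bullet> (e \<cdot>\<^sub>v col W 0) = e * (col W i \<bullet> col W 0)" using W n by simp
    also have "col W i \<bullet> col W 0 = (transpose_mat W * W) $$ (i, 0)" using W i n by simp
    also have "e * \<dots> = (if i = 0 then e else 0)" unfolding WW using i n by simp
    finally show ?thesis .
  qed
  define C1 where "C1 = mat 1 1 (\<lambda>_. e)"
  define C3 where "C3 = mat m m (\<lambda>(i, j). C $$ (Suc i, Suc j))"
  have C1: "C1 \<in> carrier_mat 1 1" and C3: "C3 \<in> carrier_mat m m" unfolding C1_def C3_def by auto
  have C0': "C $$ (0, i) = (if i = 0 then e else 0)" if "i < n" for i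
    using C0[OF that] C_sym[OF that, of 0] n by simp
  have C_block: "C = four_block_mat C1 (0\<^sub>m 1 m) (0\<^sub>m m 1) C3"
  proof (rule eq_matI)
    fix i j assume "i < dim_row (four_block_mat C1 (0\<^sub>m 1 m) (0\<^sub>m m 1) C3)"
      and "j < dim_col (four_block_mat C1 (0\<^sub>m 1 m) (0\<^sub>m m 1) C3)"
    hence "i < n" "j < n" using C1 C3 n by auto
    thus "C $$ (i, j) = four_block_mat C1 (0\<^sub>m 1 m) (0\<^sub>m m 1) C3 $$ (i, j)"
      using n C0[of i] C0'[of j] by (cases i; cases j) (auto simp: C1_def C3_def)
  qed (use C C1 C3 n in auto)
  have sym3: "transpose_mat C3 = C3"
    by (rule eq_matI) (auto simp: C3_def C_sym n)
  have "similar_mat_wit C A (transpose_mat W) W"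
    by (rule similar_mat_witI[OF WW WW' C_def C A WT W])
  hence "char_poly C = char_poly A" by (intro char_poly_similar) (auto simp: similar_mat_def)
  moreover have "char_poly C = char_poly C1 * char_poly C3"
    unfolding C_block by (rule char_poly_four_block_zeros_col[OF C1 _ C3]) auto
  moreover have "char_poly C1 = [: -e, 1 :]"
    by (simp add: C1_def char_poly_defs det_def sign_def)
  ultimately have "char_poly C3 = (\<Prod>e \<leftarrow> es. [:- e, 1:])"
    using cp by (metis mult_cancel_left pCons_eq_0_iff zero_neq_one)
  from Cons.IH[OF C3 sym3 this] obtain U where U: "U \<in> carrier_mat m m"
    and UU: "transpose_mat U * U = 1\<^sub>m m"
    and UCU: "transpose_mat U * C3 * U = mat_diag m (\<lambda>i. es ! i)" by auto
  define F where "F = four_block_mat (1\<^sub>m 1) (0\<^sub>m 1 m) (0\<^sub>m m 1) U"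
  have F: "F \<in> carrier_mat n n" unfolding F_def n using U by auto
  have FT_block: "transpose_mat F = four_block_mat (1\<^sub>m 1) (0\<^sub>m 1 m) (0\<^sub>m m 1) (transpose_mat U)"
    unfolding F_def using U by (subst transpose_four_block_mat[of _ 1 1 _ m _ m]) auto
  have FT: "transpose_mat F \<in> carrier_mat n n" using F by simp
  have FF: "transpose_mat F * F = 1\<^sub>m n"
    unfolding FT_block unfolding F_def using U UU n
    by (subst mult_four_block_mat[of _ 1 1 _ m _ m _ _ 1 _ m]) auto
  have FCF: "transpose_mat F * C * F = mat_diag n (\<lambda>i. (e # es) ! i)"
  proof -
    have 1: "transpose_mat F * C = four_block_mat C1 (0\<^sub>m 1 m) (0\<^sub>m m 1) (transpose_mat U * C3)"
      unfolding FT_block C_block using U C1 C3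
      by (subst mult_four_block_mat[of _ 1 1 _ m _ m _ _ 1 _ m]) auto
    have "transpose_mat F * C * F
        = four_block_mat C1 (0\<^sub>m 1 m) (0\<^sub>m m 1) (transpose_mat U * C3 * U)"
      unfolding 1 unfolding F_def using U C1 C3
      by (subst mult_four_block_mat[of _ 1 1 _ m _ m _ _ 1 _ m]) auto
    also have "\<dots> = mat_diag n (\<lambda>i. (e # es) ! i)"
      unfolding UCU by (rule eq_matI) (auto simp: n C1_def mat_diag_def nth_Cons')
    finally show ?thesis .
  qed
  have T: "transpose_mat (W * F) = transpose_mat F * transpose_mat W"
    by (rule transpose_mult[OF W F])
  have 1: "transpose_mat (W * F) * (W * F) = transpose_mat F * (transpose_mat W * W) * F"
    unfolding T using W F WT FT
    by (simp add: assoc_mult_mat[of _ n n _ n _ n] mult_carrier_mat[of _ n n _ n])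
  have 2: "transpose_mat (W * F) * A * (W * F) = transpose_mat F * C * F"
    unfolding T C_def using W F WT FT A
    by (simp add: assoc_mult_mat[of _ n n _ n _ n] mult_carrier_mat[of _ n n _ n])
  show ?case
  proof (intro bexI conjI)
    show "transpose_mat (W * F) * (W * F) = 1\<^sub>m n" unfolding 1 WW using FF F FT by simp
    show "transpose_mat (W * F) * A * (W * F) = mat_diag n (\<lambda>i. (e # es) ! i)"
      unfolding 2 by (rule FCF)
  qed (use W F in auto)
qed

text \<open>
  If \<open>A v = a v\<close>, then moving the real symmetric matrix \<open>A\<close> across the scalar product of \<open>v\<close>
  with its conjugate shows \<open>a \<parallel>v\<parallel>\<^sup>2 = cnj a \<parallel>v\<parallel>\<^sup>2\<close>.
\<close>

lemma symmetric_complex_eigenvalue_real: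
  fixes A :: "real mat"
  assumes A: "A \<in> carrier_mat n n" and sym: "transpose_mat A = A"
    and ev: "eigenvalue (map_mat complex_of_real A) a"
  shows "a \<in> \<real>"
proof -
  let ?A = "map_mat complex_of_real A"
  have A': "?A \<in> carrier_mat n n" using A by simp
  obtain v where v: "v \<in> carrier_vec n" "v \<noteq> 0\<^sub>v n" and Av: "?A *\<^sub>v v = a \<cdot>\<^sub>v v"
    using ev A unfolding eigenvalue_def eigenvector_def by auto
  have cv: "conjugate v \<in> carrier_vec n" using v(1) by simp
  have symA: "transpose_mat ?A = ?A" using sym by (metis map_mat_transpose)
  have conjA: "?A *\<^sub>v conjugate v = conjugate (?A *\<^sub>v v)"
  proof (rule eq_vecI)
    fix i assume "i < dim_vec (conjugate (?A *\<^sub>v v))"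
    hence i: "i < n" using A by simp
    show "(?A *\<^sub>v conjugate v) $ i = conjugate (?A *\<^sub>v v) $ i"
      using i A v(1) by (simp add: scalar_prod_def)
  qed (use A in simp)
  have "a * (conjugate v \<bullet> v) = conjugate v \<bullet> (?A *\<^sub>v v)" unfolding Av using v(1) cv by simp
  also have "\<dots> = (transpose_mat ?A *\<^sub>v conjugate v) \<bullet> v"
    by (rule transpose_vec_mult_scalar[OF A' v(1) cv, symmetric])
  also have "\<dots> = cnj a * (conjugate v \<bullet> v)"
    unfolding symA conjA Av using v(1) cv by (simp add: conjugate_smult_vec)
  finally have "a * (conjugate v \<bullet> v) = cnj a * (conjugate v \<bullet> v)" .
  moreover have "conjugate v \<bullet> v \<noteq> 0"
    using conjugate_square_eq_0_vec[OF v(1)] v conjugate_vec_sprod_comm[OF v(1) v(1)] by simp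
  ultimately have "cnj a = a" by simp
  thus ?thesis by (simp add: Reals_cnj_iff)
qed

text \<open>
  The factorisation over \<open>\<complex>\<close> has only real roots, hence it descends to \<open>\<real>\<close>.
\<close>

lemma symmetric_char_poly_splits:
  fixes A :: "real mat"
  assumes A: "A \<in> carrier_mat n n" and sym: "transpose_mat A = A"
  obtains es where "char_poly A = (\<Prod>e\<leftarrow>es. [:- e, 1:])" and "length es = n"
proof -
  let ?A = "map_mat complex_of_real A"
  have A': "?A \<in> carrier_mat n n" using A by simp
  from char_poly_factorized[OF A'] obtain as
    where as: "char_poly ?A = (\<Prod>a\<leftarrow>as. [:- a, 1:])" "length as = n" by blast
  interpret h: map_poly_inj_idom_hom complex_of_real ..
  have "complex_of_real (Re a) = a" if "a \<in> set as" for a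
  proof -
    have "poly (char_poly ?A) a = 0"
      unfolding as(1) poly_prod_list using that by (auto simp: prod_list_zero_iff image_iff)
    hence "eigenvalue ?A a" using eigenvalue_root_char_poly[OF A'] by simp
    thus ?thesis using symmetric_complex_eigenvalue_real[OF A sym] by (simp add: of_real_Re)
  qed
  hence as_Re: "as = map complex_of_real (map Re as)" by (simp add: map_idI)
  have "map_poly complex_of_real (char_poly A) = char_poly ?A"
    by (rule of_real_hom.char_poly_hom[OF A, symmetric])
  also have "\<dots> = map_poly complex_of_real (\<Prod>e\<leftarrow>map Re as. [:- e, 1:])"
    unfolding as(1) by (subst as_Re) (simp add: h.hom_prod_list o_def)
  finally have "char_poly A = (\<Prod>e\<leftarrow>map Re as. [:- e, 1:])" by (rule h.injectivity)
  with as(2) that show ?thesis by (metis length_map)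
qed

section \<open>Rayleigh quotients and the ordered eigenvalues\<close>

lemma proots_prod_linear_factors:
  fixes es :: "'a :: idom list"
  shows "proots (\<Prod>e\<leftarrow>es. [:- e, 1:]) = mset es"
proof (induction es)
  case (Cons e es)
  have "(\<Prod>e\<leftarrow>es. [:- e, 1:]) \<noteq> 0" by (auto simp: prod_list_zero_iff)
  hence "proots ([:- e, 1:] * (\<Prod>e\<leftarrow>es. [:- e, 1:]))
      = proots [:- e, 1:] + proots (\<Prod>e\<leftarrow>es. [:- e, 1:])"
    by (intro proots_mult) auto
  with Cons show ?case by simp
qed simp

text \<open>
  Because the characteristic polynomial splits, its list of real roots misses no eigenvalue; in
  particular its entries at the positions \<open>1\<close> and \<open>n - 1\<close> are meaningful as soon as \<open>n \<ge> 2\<close>.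
\<close>

lemma symmetric_eigenvalue_list:
  assumes A: "A \<in> carrier_mat n n" and sym: "transpose_mat A = A"
  shows "char_poly A = (\<Prod>e\<leftarrow>eigenvalue_list A. [:- e, 1:])"
    and "length (eigenvalue_list A) = n"
    and "sorted (rev (eigenvalue_list A))"
proof -
  obtain es where es: "char_poly A = (\<Prod>e\<leftarrow>es. [:- e, 1:])" "length es = n"
    using symmetric_char_poly_splits[OF A sym] .
  have "proots (char_poly A) = mset es" unfolding es(1) by (rule proots_prod_linear_factors)
  hence "mset (eigenvalue_list A) = mset es" unfolding eigenvalue_list_def by simp
  hence "mset (map (\<lambda>e. [:- e, 1:]) es) = mset (map (\<lambda>e. [:- e, 1:]) (eigenvalue_list A))"
    and len: "length (eigenvalue_list A) = length es"
    by (auto dest: mset_eq_length)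
  thus "char_poly A = (\<Prod>e\<leftarrow>eigenvalue_list A. [:- e, 1:])"
    unfolding es(1) by (metis prod_mset_prod_list)
  from len es(2) show "length (eigenvalue_list A) = n" by simp
  show "sorted (rev (eigenvalue_list A))" unfolding eigenvalue_list_def by simp
qed

text \<open>
  In the coordinates of an orthonormal eigenbasis, listed in the order of the eigenvalues, the
  quadratic form of \<open>A\<close> is a weighted sum of squares. The matrix \<open>U\<close> maps a vector to these
  coordinates.
\<close>

lemma symmetric_quadratic_form:
  fixes A :: "real mat"
  assumes A: "A \<in> carrier_mat n n" and sym: "transpose_mat A = A"
  obtains U where "U \<in> carrier_mat n n"
    and "\<And>x. x \<in> carrier_vec n \<Longrightarrow> x \<bullet> x = (\<Sum>i<n. ((U *\<^sub>v x) $ i)\<^sup>2)"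
    and "\<And>x. x \<in> carrier_vec n \<Longrightarrow>
           x \<bullet> (A *\<^sub>v x) = (\<Sum>i<n. eigenvalue_list A ! i * ((U *\<^sub>v x) $ i)\<^sup>2)"
proof -
  from symmetric_orthogonal_diagonalisation[OF A sym symmetric_eigenvalue_list(1)[OF A sym]]
  obtain V where V: "V \<in> carrier_mat n n" and VV: "transpose_mat V * V = 1\<^sub>m n"
    and VAV: "transpose_mat V * A * V = mat_diag n (\<lambda>i. eigenvalue_list A ! i)" by auto
  let ?U = "transpose_mat V"
  have U: "?U \<in> carrier_mat n n" using V by simp
  have VV': "V * ?U = 1\<^sub>m n" by (rule mat_mult_left_right_inverse[OF U V VV])
  have 1: "x \<bullet> x = (\<Sum>i<n. ((?U *\<^sub>v x) $ i)\<^sup>2)" if x: "x \<in> carrier_vec n" for x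
  proof -
    have Ux: "?U *\<^sub>v x \<in> carrier_vec n" using U x by simp
    have "(?U *\<^sub>v x) \<bullet> (?U *\<^sub>v x) = x \<bullet> (V *\<^sub>v (?U *\<^sub>v x))"
      by (rule transpose_vec_mult_scalar[OF V Ux x])
    also have "V *\<^sub>v (?U *\<^sub>v x) = (V * ?U) *\<^sub>v x" using V U x by (intro assoc_mult_mat_vec[symmetric])
    finally show ?thesis
      using x V by (simp add: VV' scalar_prod_def power2_eq_square lessThan_atLeast0)
  qed
  have 2: "x \<bullet> (A *\<^sub>v x) = (\<Sum>i<n. eigenvalue_list A ! i * ((?U *\<^sub>v x) $ i)\<^sup>2)"
    if x: "x \<in> carrier_vec n" for x
  proof -
    define c where "c = ?U *\<^sub>v x"
    have c: "c \<in> carrier_vec n" using U x by (simp add: c_def)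
    have xc: "x = V *\<^sub>v c"
      unfolding c_def using VV' x by (subst assoc_mult_mat_vec[OF V U x, symmetric]) simp
    have Vc: "V *\<^sub>v c \<in> carrier_vec n" using V c by simp
    have "x \<bullet> (A *\<^sub>v x) = (V *\<^sub>v c) \<bullet> (A *\<^sub>v (V *\<^sub>v c))" unfolding xc ..
    also have "\<dots> = c \<bullet> (?U *\<^sub>v (A *\<^sub>v (V *\<^sub>v c)))"
      using transpose_vec_mult_scalar[OF U _ c, of "A *\<^sub>v (V *\<^sub>v c)"] A V c by simp
    also have "?U *\<^sub>v (A *\<^sub>v (V *\<^sub>v c)) = (?U * A * V) *\<^sub>v c"
      using U A V c Vc by (simp add: assoc_mult_mat_vec[of _ n n _ n] mult_carrier_mat[of _ n n _ n])
    also have "\<dots> = mat_diag n (\<lambda>i. eigenvalue_list A ! i) *\<^sub>v c" unfolding VAV ..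
    also have "\<dots> = vec n (\<lambda>i. eigenvalue_list A ! i * c $ i)"
      using c by (intro eq_vecI)
        (auto simp: mat_diag_def scalar_prod_def if_distrib[of "\<lambda>z. z * _"] cong: if_cong)
    also have "c \<bullet> \<dots> = (\<Sum>i<n. eigenvalue_list A ! i * (c $ i)\<^sup>2)"
      using c by (auto simp: scalar_prod_def power2_eq_square lessThan_atLeast0 intro!: sum.cong)
    finally show ?thesis unfolding c_def .
  qed
  show ?thesis by (rule that[OF U 1 2])
qed

lemma eigenvalue_list_decreasing:
  assumes A: "A \<in> carrier_mat n n" and sym: "transpose_mat A = A" and "i \<le> j" and "j < n"
  shows "eigenvalue_list A ! j \<le> eigenvalue_list A ! i"
  using symmetric_eigenvalue_list(2,3)[OF A sym] assms(3,4)
  by (metis sorted_rev_nth_mono)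

lemma least_eigenvalue_le_rayleigh:
  assumes A: "A \<in> carrier_mat n n" and sym: "transpose_mat A = A" and x: "x \<in> carrier_vec n"
  shows "eigenvalue_list A ! (n - 1) * (x \<bullet> x) \<le> x \<bullet> (A *\<^sub>v x)"
proof -
  obtain U where U: "x \<bullet> x = (\<Sum>i<n. ((U *\<^sub>v x) $ i)\<^sup>2)"
    "x \<bullet> (A *\<^sub>v x) = (\<Sum>i<n. eigenvalue_list A ! i * ((U *\<^sub>v x) $ i)\<^sup>2)"
    using symmetric_quadratic_form[OF A sym] x by metis
  show ?thesis unfolding U sum_distrib_left
    by (intro sum_mono mult_right_mono eigenvalue_list_decreasing[OF A sym]) auto
qed

text \<open>
  The part of the Courant--Fischer principle that concerns the second eigenvalue. On the plane
  spanned by \<open>x\<close> and \<open>y\<close>, the form \<open>z \<bullet> A z - \<rho> (z \<bullet> z)\<close> is nonnegative, as there are no cross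
  terms. The plane contains a nonzero vector orthogonal to the first eigenvector, and on such a
  vector the Rayleigh quotient is at most the second eigenvalue.
\<close>

lemma quadratic_form_le_second_eigenvalue:
  assumes A: "A \<in> carrier_mat n n" and sym: "transpose_mat A = A"
    and x: "x \<in> carrier_vec n" and y: "y \<in> carrier_vec n"
    and x0: "x \<noteq> 0\<^sub>v n" and y0: "y \<noteq> 0\<^sub>v n"
    and orth: "x \<bullet> y = 0" and A_orth: "x \<bullet> (A *\<^sub>v y) = 0"
    and \<rho>x: "\<rho> * (x \<bullet> x) \<le> x \<bullet> (A *\<^sub>v x)" and \<rho>y: "\<rho> * (y \<bullet> y) \<le> y \<bullet> (A *\<^sub>v y)"
  shows "\<rho> \<le> eigenvalue_list A ! 1"
proof -
  obtain U where U: "U \<in> carrier_mat n n"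
    and sq: "\<And>x. x \<in> carrier_vec n \<Longrightarrow> x \<bullet> x = (\<Sum>i<n. ((U *\<^sub>v x) $ i)\<^sup>2)"
    and qf: "\<And>x. x \<in> carrier_vec n \<Longrightarrow>
      x \<bullet> (A *\<^sub>v x) = (\<Sum>i<n. eigenvalue_list A ! i * ((U *\<^sub>v x) $ i)\<^sup>2)"
    by (rule symmetric_quadratic_form[OF A sym]) blast
  have n: "0 < n" using x x0 by (cases n) auto
  \<comment> \<open>The coordinate with index 0 belongs to the largest eigenvalue; one linear condition
    always has a nontrivial solution in two unknowns.\<close>
  obtain a b where ab: "a * (U *\<^sub>v x) $ 0 + b * (U *\<^sub>v y) $ 0 = 0" "a \<noteq> 0 \<or> b \<noteq> 0"
  proof (cases "(U *\<^sub>v y) $ 0 = 0")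
    case True
    with that[of 0 1] show ?thesis by simp
  next
    case False
    with that[of "(U *\<^sub>v y) $ 0" "- (U *\<^sub>v x) $ 0"] show ?thesis by simp
  qed
  define z where "z = a \<cdot>\<^sub>v x + b \<cdot>\<^sub>v y"
  have z: "z \<in> carrier_vec n" using x y by (simp add: z_def)
  have Uz: "U *\<^sub>v z = a \<cdot>\<^sub>v (U *\<^sub>v x) + b \<cdot>\<^sub>v (U *\<^sub>v y)"
    unfolding z_def using U x y
    by (simp add: mult_add_distrib_mat_vec[of _ n n] mult_mat_vec[of _ n n])
  have Uz0: "(U *\<^sub>v z) $ 0 = 0" unfolding Uz using ab(1) U n by simp
  have Az: "A *\<^sub>v z = a \<cdot>\<^sub>v (A *\<^sub>v x) + b \<cdot>\<^sub>v (A *\<^sub>v y)"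
    unfolding z_def using A x y
    by (simp add: mult_add_distrib_mat_vec[of _ n n] mult_mat_vec[of _ n n])
  have Ax: "A *\<^sub>v x \<in> carrier_vec n" and Ay: "A *\<^sub>v y \<in> carrier_vec n" using A x y by auto
  have orth': "y \<bullet> x = 0" using orth comm_scalar_prod[OF x y] by simp
  have A_orth': "y \<bullet> (A *\<^sub>v x) = 0"
    using A_orth transpose_vec_mult_scalar[OF A x y] comm_scalar_prod[OF x Ay] sym by simp
  have zz: "z \<bullet> z = a\<^sup>2 * (x \<bullet> x) + b\<^sup>2 * (y \<bullet> y)"
    unfolding z_def using x y orth orth'
    by (simp add: scalar_prod_add_distrib[of _ n] add_scalar_prod_distrib[of _ n] power2_eq_square)
  have zAz: "z \<bullet> (A *\<^sub>v z) = a\<^sup>2 * (x \<bullet> (A *\<^sub>v x)) + b\<^sup>2 * (y \<bullet> (A *\<^sub>v y))"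
    unfolding Az unfolding z_def using x y Ax Ay A_orth A_orth'
    by (simp add: scalar_prod_add_distrib[of _ n] add_scalar_prod_distrib[of _ n] power2_eq_square)
  have pos: "0 < x \<bullet> x" "0 < y \<bullet> y"
    using conjugate_square_greater_0_vec[OF x] x0 conjugate_square_greater_0_vec[OF y] y0 by auto
  have zz_pos: "0 < z \<bullet> z" unfolding zz using pos ab(2)
    by (smt (verit, best) mult_nonneg_nonneg mult_pos_pos zero_le_power2 zero_less_power2)
  have "\<rho> * (z \<bullet> z) = a\<^sup>2 * (\<rho> * (x \<bullet> x)) + b\<^sup>2 * (\<rho> * (y \<bullet> y))"
    unfolding zz by (simp add: algebra_simps)
  also have "\<dots> \<le> z \<bullet> (A *\<^sub>v z)" unfolding zAz
    by (intro add_mono mult_left_mono \<rho>x \<rho>y) auto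
  also have "\<dots> \<le> (\<Sum>i<n. eigenvalue_list A ! 1 * ((U *\<^sub>v z) $ i)\<^sup>2)" unfolding qf[OF z]
  proof (rule sum_mono)
    fix i assume i: "i \<in> {..<n}"
    show "eigenvalue_list A ! i * ((U *\<^sub>v z) $ i)\<^sup>2 \<le> eigenvalue_list A ! 1 * ((U *\<^sub>v z) $ i)\<^sup>2"
    proof (cases "i = 0")
      case False
      with i show ?thesis
        by (intro mult_right_mono eigenvalue_list_decreasing[OF A sym]) auto
    qed (simp add: Uz0)
  qed
  also have "\<dots> = eigenvalue_list A ! 1 * (z \<bullet> z)" unfolding sq[OF z] sum_distrib_left ..
  finally show ?thesis using zz_pos by simp
qed

text \<open>
  The model case of \<open>x\<close> is a \<open>0\<close>-\<open>1\<close> vector with \<open>s\<close> ones. The number \<open>\<rho>\<close> is the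
  Rayleigh quotient of the projection of \<open>x\<close> to the complement of the all-one vector, an eigenvector for \<open>r\<close>. So \<open>\<rho>\<close> is at least the
  smallest eigenvalue. The condition \<open>x \<bullet> A x \<le> r s\<close> says exactly that \<open>\<rho> \<le> r\<close>, hence both
  the all-one vector and the projection have Rayleigh quotient at least \<open>\<rho>\<close>, and the plane that
  they span shows that \<open>\<rho>\<close> is at most the second eigenvalue.
\<close>

lemma constant_row_sum_rayleigh:
  fixes A :: "real mat" and r :: real
  assumes A: "A \<in> carrier_mat m m" and sym: "transpose_mat A = A"
    and row: "A *\<^sub>v vec m (\<lambda>_. 1) = r \<cdot>\<^sub>v vec m (\<lambda>_. 1)"
    and x: "x \<in> carrier_vec m" and x1: "x \<bullet> vec m (\<lambda>_. 1) = s" and xx: "x \<bullet> x = s"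
    and s: "0 < s" "s < m" and q: "x \<bullet> (A *\<^sub>v x) \<le> r * s"
  defines "\<rho> \<equiv> (m * (x \<bullet> (A *\<^sub>v x)) - r * s\<^sup>2) / (s * (m - s))"
  shows "eigenvalue_list A ! (m - 1) \<le> \<rho>" and "\<rho> \<le> eigenvalue_list A ! 1"
proof -
  let ?q = "x \<bullet> (A *\<^sub>v x)"
  let ?j = "vec m (\<lambda>_. 1) :: real vec"
  have j: "?j \<in> carrier_vec m" by simp
  have m: "0 < real m" using s by linarith
  have jj: "?j \<bullet> ?j = m" by (simp add: scalar_prod_def)
  define t where "t = s / m"
  \<comment> \<open>The projection of x along the all-one vector.\<close>
  define y where "y = x + (- t) \<cdot>\<^sub>v ?j"
  have y: "y \<in> carrier_vec m" using x by (simp add: y_def)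
  have jx: "?j \<bullet> x = s" using comm_scalar_prod[OF j x] x1 by simp
  have tm: "t * m = s" using m by (simp add: t_def)
  have Ay: "A *\<^sub>v y = A *\<^sub>v x + (- t * r) \<cdot>\<^sub>v ?j"
    unfolding y_def using A x row
    by (simp add: mult_add_distrib_mat_vec[of _ m m] mult_mat_vec[of _ m m] smult_smult_assoc)
  have Ax: "A *\<^sub>v x \<in> carrier_vec m" using A x by simp
  have jAx: "?j \<bullet> (A *\<^sub>v x) = r * s"
    using transpose_vec_mult_scalar[OF A x j] sym row jx x by simp
  have jy: "?j \<bullet> y = 0"
    unfolding y_def using x jx jj tm by (simp add: scalar_prod_add_distrib[of _ m])
  have jAy: "?j \<bullet> (A *\<^sub>v y) = 0"
    unfolding Ay using Ax jAx jj tm by (simp add: scalar_prod_add_distrib[of _ m] algebra_simps)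
  have yy: "y \<bullet> y = s * (m - s) / m"
  proof -
    have "y \<bullet> y = x \<bullet> y + (- t) * (?j \<bullet> y)"
      unfolding y_def[of] using x by (subst add_scalar_prod_distrib[of _ m]) (auto simp: y_def)
    also have "x \<bullet> y = s - t * s"
      unfolding y_def using x xx x1 by (simp add: scalar_prod_add_distrib[of _ m])
    finally show ?thesis using m by (simp add: jy t_def field_simps)
  qed
  have yAy: "y \<bullet> (A *\<^sub>v y) = ?q - r * s\<^sup>2 / m"
  proof -
    have "y \<bullet> (A *\<^sub>v y) = x \<bullet> (A *\<^sub>v y) + (- t) * (?j \<bullet> (A *\<^sub>v y))"
      using x A y by (subst (1) y_def, subst add_scalar_prod_distrib[of _ m]) auto
    also have "x \<bullet> (A *\<^sub>v y) = ?q - t * r * s"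
      unfolding Ay using x Ax x1 by (simp add: scalar_prod_add_distrib[of _ m])
    finally show ?thesis using m by (simp add: jAy t_def field_simps power2_eq_square)
  qed
  have yy_pos: "0 < y \<bullet> y" unfolding yy using s m by simp
  have \<rho>: "\<rho> * (y \<bullet> y) = y \<bullet> (A *\<^sub>v y)"
    unfolding yy yAy \<rho>_def using s m by (simp add: field_simps)
  show "eigenvalue_list A ! (m - 1) \<le> \<rho>"
    using least_eigenvalue_le_rayleigh[OF A sym y] yy_pos unfolding \<rho>[symmetric] by simp
  show "\<rho> \<le> eigenvalue_list A ! 1"
  proof (rule quadratic_form_le_second_eigenvalue[OF A sym j y])
    show "?j \<noteq> 0\<^sub>v m" using jj m by auto
    show "y \<noteq> 0\<^sub>v m" using yy_pos by auto
    have "m * ?q - r * s\<^sup>2 \<le> m * (r * s) - r * s\<^sup>2" using q m by simp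
    also have "\<dots> = r * (s * (m - s))" by (simp add: algebra_simps power2_eq_square)
    finally have "\<rho> \<le> r" unfolding \<rho>_def using s by (simp add: divide_le_eq)
    thus "\<rho> * (?j \<bullet> ?j) \<le> ?j \<bullet> (A *\<^sub>v ?j)"
      unfolding row using m by (simp add: jj mult_right_mono)
    show "\<rho> * (y \<bullet> y) \<le> y \<bullet> (A *\<^sub>v y)" using \<rho> by simp
  qed (rule jy jAy)+
qed

section \<open>Degrees and edge counts in induced submixed graphs\<close>

text \<open>
  An edge at \<open>u\<close> is counted at its other end. For a loop this end is \<open>u\<close> itself, and the factor
  two in the diagonal entry matches the double counting of loops in the degree.
\<close>

lemma (in mixed_graph) edge_degree_eq_sum:
  assumes u: "u \<in> verts G"
  shows "edge_degree G u = (\<Sum>v\<in>verts G. edge_count G u v)"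
proof -
  let ?E = "\<lambda>v. {e \<in> edges G. ends G e = {u, v}}"
  have fin: "finite (?E v)" for v using finite_edges by simp
  have "\<exists>v\<in>verts G. ends G e = {u, v}" if "e \<in> edges G" "u \<in> ends G e" for e
  proof -
    obtain a b where "a \<in> verts G" "b \<in> verts G" "ends G e = {a, b}"
      using ends_in_verts[OF \<open>e \<in> edges G\<close>] by blast
    with that(2) show ?thesis by (cases "u = a") (auto simp: insert_commute)
  qed
  hence "{e \<in> edges G. u \<in> ends G e} = (\<Union>v\<in>verts G. ?E v)" by blast
  moreover have "card (\<Union>v\<in>verts G. ?E v) = (\<Sum>v\<in>verts G. card (?E v))"
    by (intro card_UN_disjoint finite_verts ballI impI fin) (auto simp: doubleton_eq_iff)
  ultimately have "edge_degree G u = (\<Sum>v\<in>verts G. card (?E v)) + card (?E u)"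
    unfolding edge_degree_def by simp
  also have "\<dots> = (\<Sum>v\<in>verts G. card (?E v) + (if v = u then card (?E u) else 0))"
    using u finite_verts by (simp add: sum.distrib)
  also have "\<dots> = (\<Sum>v\<in>verts G. edge_count G u v)"
    by (intro sum.cong) (auto simp: edge_count_def)
  finally show ?thesis .
qed

lemma (in mixed_graph) out_degree_eq_sum: "out_degree G u = (\<Sum>v\<in>verts G. arc_count G u v)"
proof -
  have "{a \<in> arcs G. tail G a = u} = (\<Union>v\<in>verts G. {a \<in> arcs G. tail G a = u \<and> head G a = v})"
    using head_in_verts by auto
  thus ?thesis unfolding out_degree_def arc_count_def
    by (simp, subst card_UN_disjoint) (auto simp: finite_verts finite_arcs)
qed

lemma (in mixed_graph) in_degree_eq_sum: "in_degree G u = (\<Sum>v\<in>verts G. arc_count G v u)"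
proof -
  have "{a \<in> arcs G. head G a = u} = (\<Union>v\<in>verts G. {a \<in> arcs G. tail G a = v \<and> head G a = u})"
    using tail_in_verts by auto
  thus ?thesis unfolding in_degree_def arc_count_def
    by (simp, subst card_UN_disjoint) (auto simp: finite_verts finite_arcs)
qed

lemma (in mixed_graph) mixed_graph_induce:
  assumes "W \<noteq> {}" and "W \<subseteq> verts G"
  shows "mixed_graph (induce G W)"
proof
  fix e assume "e \<in> edges (induce G W)"
  thus "\<exists>u\<in>verts (induce G W). \<exists>v\<in>verts (induce G W). ends (induce G W) e = {u, v}"
    using ends_in_verts[of e] by (auto simp: induce_def)
qed (use assms finite_subset[OF assms(2) finite_verts] finite_edges finite_arcs
      in \<open>auto simp: induce_def\<close>)

lemma edge_count_induce:
  "u \<in> W \<Longrightarrow> v \<in> W \<Longrightarrow> edge_count (induce G W) u v = edge_count G u v"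
  unfolding edge_count_def induce_def by (auto intro!: arg_cong[of _ _ card])

lemma arc_count_induce:
  "u \<in> W \<Longrightarrow> v \<in> W \<Longrightarrow> arc_count (induce G W) u v = arc_count G u v"
  unfolding arc_count_def induce_def by (auto intro!: arg_cong[of _ _ card])

lemma (in mixed_graph) degrees_induce_le:
  shows "edge_degree (induce G W) u \<le> edge_degree G u"
    and "out_degree (induce G W) u \<le> out_degree G u"
    and "in_degree (induce G W) u \<le> in_degree G u"
  unfolding edge_degree_def out_degree_def in_degree_def induce_def
  by (intro add_mono card_mono; use finite_edges finite_arcs in auto)+

section \<open>The integrated adjacency matrix as a quadratic form\<close>

definition indicator_vec :: "'a list \<Rightarrow> 'a set \<Rightarrow> real vec" where
  "indicator_vec vs W = vec (length vs) (\<lambda>i. if vs ! i \<in> W then 1 else 0)"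

text \<open>
  The common shape of the blocks \<open>A\<close>, \<open>D\<close> and the transpose of \<open>D\<close>.
\<close>

definition count_matrix :: "'a list \<Rightarrow> ('a \<Rightarrow> 'a \<Rightarrow> nat) \<Rightarrow> real mat" where
  "count_matrix vs f = mat (length vs) (length vs) (\<lambda>(i, j). real (f (vs ! i) (vs ! j)))"

lemma indicator_vec_carrier [simp]: "indicator_vec vs W \<in> carrier_vec (length vs)"
  by (simp add: indicator_vec_def)

lemma count_matrix_carrier [simp]: "count_matrix vs f \<in> carrier_mat (length vs) (length vs)"
  by (simp add: count_matrix_def)

lemma scalar_prod_indicator_vec:
  assumes "distinct vs" and W: "W \<subseteq> set vs"
  shows "vec (length vs) (\<lambda>i. g (vs ! i)) \<bullet> indicator_vec vs W = (\<Sum>v\<in>W. g v)"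
proof -
  have "vec (length vs) (\<lambda>i. g (vs ! i)) \<bullet> indicator_vec vs W
      = (\<Sum>i<length vs. if vs ! i \<in> W then g (vs ! i) else 0)"
    by (auto simp: scalar_prod_def indicator_vec_def lessThan_atLeast0 intro!: sum.cong)
  also have "\<dots> = (\<Sum>v\<in>set vs. if v \<in> W then g v else 0)"
    by (rule sum.reindex_bij_betw[OF bij_betw_nth[OF assms(1) refl refl],
          of "\<lambda>v. if v \<in> W then g v else 0"])
  also have "\<dots> = (\<Sum>v\<in>W. g v)"
    using W by (simp add: sum.inter_restrict[symmetric] Int_absorb1)
  finally show ?thesis .
qed

lemma count_matrix_mult_indicator_vec:
  assumes "distinct vs" and "W \<subseteq> set vs"
  shows "count_matrix vs f *\<^sub>v indicator_vec vs W
       = vec (length vs) (\<lambda>i. \<Sum>v\<in>W. real (f (vs ! i) v))"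
proof (rule eq_vecI)
  fix i assume "i < dim_vec (vec (length vs) (\<lambda>i. \<Sum>v\<in>W. real (f (vs ! i) v)))"
  hence i: "i < length vs" by simp
  have "row (count_matrix vs f) i = vec (length vs) (\<lambda>j. real (f (vs ! i) (vs ! j)))"
    using i by (auto simp: count_matrix_def)
  with i show "(count_matrix vs f *\<^sub>v indicator_vec vs W) $ i
    = vec (length vs) (\<lambda>i. \<Sum>v\<in>W. real (f (vs ! i) v)) $ i"
    using scalar_prod_indicator_vec[OF assms, of "\<lambda>v. real (f (vs ! i) v)"]
    by (simp add: count_matrix_def)
qed (simp add: count_matrix_def)

lemma edge_count_commute: "edge_count G u v = edge_count G v u"
  by (simp add: edge_count_def insert_commute)

lemma integrated_adjacency_matrix_count:
  "integrated_adjacency_matrix G vs =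
     four_block_mat (count_matrix vs (edge_count G)) (count_matrix vs (arc_count G))
       (count_matrix vs (\<lambda>u v. arc_count G v u)) (count_matrix vs (edge_count G))"
proof -
  have "transpose_mat (count_matrix vs (arc_count G)) = count_matrix vs (\<lambda>u v. arc_count G v u)"
    by (rule eq_matI) (auto simp: count_matrix_def)
  thus ?thesis by (simp add: integrated_adjacency_matrix_def Let_def count_matrix_def)
qed

lemma integrated_adjacency_matrix_carrier:
  "integrated_adjacency_matrix G vs \<in> carrier_mat (length vs + length vs) (length vs + length vs)"
  unfolding integrated_adjacency_matrix_count by (intro four_block_carrier_mat) simp_all

lemma integrated_adjacency_matrix_symmetric:
  "transpose_mat (integrated_adjacency_matrix G vs) = integrated_adjacency_matrix G vs"
proof -
  have T: "transpose_mat (count_matrix vs f) = count_matrix vs (\<lambda>u v. f v u)" for f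
    by (rule eq_matI) (auto simp: count_matrix_def)
  have "(\<lambda>u v. edge_count G v u) = edge_count G" by (intro ext edge_count_commute)
  thus ?thesis unfolding integrated_adjacency_matrix_count
    by (subst transpose_four_block_mat[of _ "length vs" "length vs" _ "length vs" _ "length vs"])
      (simp_all add: T)
qed

lemma integrated_adjacency_matrix_mult_indicator:
  assumes "distinct vs" and "W \<subseteq> set vs"
  shows "integrated_adjacency_matrix G vs *\<^sub>v (indicator_vec vs W @\<^sub>v indicator_vec vs W)
       = vec (length vs) (\<lambda>i. \<Sum>v\<in>W. real (edge_count G (vs ! i) v + arc_count G (vs ! i) v))
         @\<^sub>v vec (length vs) (\<lambda>i. \<Sum>v\<in>W. real (edge_count G (vs ! i) v + arc_count G v (vs ! i)))"
proof -
  have "integrated_adjacency_matrix G vs *\<^sub>v (indicator_vec vs W @\<^sub>v indicator_vec vs W)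
      = (count_matrix vs (edge_count G) *\<^sub>v indicator_vec vs W
          + count_matrix vs (arc_count G) *\<^sub>v indicator_vec vs W)
        @\<^sub>v (count_matrix vs (\<lambda>u v. arc_count G v u) *\<^sub>v indicator_vec vs W
          + count_matrix vs (edge_count G) *\<^sub>v indicator_vec vs W)"
    unfolding integrated_adjacency_matrix_count
    by (rule four_block_mat_mult_vec[OF count_matrix_carrier count_matrix_carrier
          count_matrix_carrier count_matrix_carrier indicator_vec_carrier indicator_vec_carrier])
  also have "\<dots> = vec (length vs) (\<lambda>i. \<Sum>v\<in>W. real (edge_count G (vs ! i) v + arc_count G (vs ! i) v))
         @\<^sub>v vec (length vs) (\<lambda>i. \<Sum>v\<in>W. real (edge_count G (vs ! i) v + arc_count G v (vs ! i)))"
    unfolding count_matrix_mult_indicator_vec[OF assms]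
    by (intro arg_cong2[of _ _ _ _ append_vec] eq_vecI) (simp_all add: sum.distrib add.commute)
  finally show ?thesis .
qed

text \<open>
  The rows of the upper half sum to \<open>d(u) + d\<^sup>+(u)\<close>, those of the lower half to
  \<open>d(u) + d\<^sup>-(u)\<close>; by regularity, both are \<open>r\<close>.
\<close>

lemma regular_integrated_row_sum:
  assumes "mixed_graph G" and reg: "regular r G" and vs: "distinct vs" "set vs = verts G"
  shows "integrated_adjacency_matrix G vs *\<^sub>v vec (length vs + length vs) (\<lambda>_. 1)
       = real r \<cdot>\<^sub>v vec (length vs + length vs) (\<lambda>_. 1)"
proof -
  interpret mixed_graph G by fact
  let ?n = "length vs"
  have ones: "vec (?n + ?n) (\<lambda>_. 1) = indicator_vec vs (verts G) @\<^sub>v indicator_vec vs (verts G)"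
    unfolding indicator_vec_def vs(2)[symmetric] by (intro eq_vecI) auto
  have out_sum: "(\<Sum>v\<in>verts G. real (edge_count G u v + arc_count G u v)) = real r"
    and in_sum: "(\<Sum>v\<in>verts G. real (edge_count G u v + arc_count G v u)) = real r"
    if u: "u \<in> verts G" for u
  proof -
    have "edge_degree G u + out_degree G u = r" "edge_degree G u + in_degree G u = r"
      using reg u unfolding regular_def by auto
    hence "(\<Sum>v\<in>verts G. edge_count G u v + arc_count G u v) = r"
      and "(\<Sum>v\<in>verts G. edge_count G u v + arc_count G v u) = r"
      unfolding edge_degree_eq_sum[OF u] out_degree_eq_sum in_degree_eq_sum sum.distrib .
    thus "(\<Sum>v\<in>verts G. real (edge_count G u v + arc_count G u v)) = real r"
      and "(\<Sum>v\<in>verts G. real (edge_count G u v + arc_count G v u)) = real r"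
      by (simp_all only: of_nat_sum[symmetric])
  qed
  have vsi: "vs ! i \<in> verts G" if "i < ?n" for i using that vs(2) nth_mem by metis
  show ?thesis
    unfolding ones integrated_adjacency_matrix_mult_indicator[OF vs(1) eq_refl[OF vs(2)[symmetric]]]
    unfolding ones[symmetric]
    by (intro eq_vecI) (auto simp: out_sum[OF vsi] in_sum[OF vsi] simp del: of_nat_add)
qed

text \<open>
  Since \<open>W\<close> is selected in both halves, each of the two blocks \<open>A\<close> contributes the edge degrees
  of the induced submixed graph, \<open>D\<close> its out-degrees and the transpose of \<open>D\<close> its in-degrees.
\<close>

lemma induced_quadratic_form:
  assumes "mixed_graph G" and vs: "distinct vs" "set vs = verts G"
    and W: "W \<noteq> {}" "W \<subseteq> verts G"
  defines "x \<equiv> indicator_vec vs W @\<^sub>v indicator_vec vs W"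
  shows "x \<bullet> (integrated_adjacency_matrix G vs *\<^sub>v x)
    = (\<Sum>u\<in>W. real (2 * edge_degree (induce G W) u + out_degree (induce G W) u
        + in_degree (induce G W) u))"
proof -
  interpret H: mixed_graph "induce G W"
    by (rule mixed_graph.mixed_graph_induce[OF assms(1) W])
  have H_verts: "verts (induce G W) = W" by (simp add: induce_def)
  have W': "W \<subseteq> set vs" using W vs by simp
  let ?n = "length vs"
  let ?f = "\<lambda>u. \<Sum>v\<in>W. real (edge_count G u v + arc_count G u v)"
  let ?g = "\<lambda>u. \<Sum>v\<in>W. real (edge_count G u v + arc_count G v u)"
  have x: "x \<in> carrier_vec (?n + ?n)" by (simp add: x_def)
  have "x \<bullet> (integrated_adjacency_matrix G vs *\<^sub>v x)
      = (integrated_adjacency_matrix G vs *\<^sub>v x) \<bullet> x"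
    using x integrated_adjacency_matrix_carrier[of G vs]
    by (intro comm_scalar_prod[of _ "?n + ?n"]) auto
  also have "\<dots> = (\<Sum>u\<in>W. ?f u) + (\<Sum>u\<in>W. ?g u)"
    unfolding x_def integrated_adjacency_matrix_mult_indicator[OF vs(1) W']
    by (subst scalar_prod_append[of _ ?n _ ?n])
      (simp_all only: indicator_vec_carrier vec_carrier scalar_prod_indicator_vec[OF vs(1) W', of ?f]
         scalar_prod_indicator_vec[OF vs(1) W', of ?g])
  also have "\<dots> = (\<Sum>u\<in>W. ?f u + ?g u)" by (rule sum.distrib[symmetric])
  also have "\<dots> = (\<Sum>u\<in>W. real (2 * edge_degree (induce G W) u + out_degree (induce G W) u
        + in_degree (induce G W) u))"
  proof (rule sum.cong[OF refl])
    fix u assume u: "u \<in> W"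
    show "?f u + ?g u = real (2 * edge_degree (induce G W) u + out_degree (induce G W) u
        + in_degree (induce G W) u)"
      using u H.edge_degree_eq_sum[of u] H.out_degree_eq_sum[of u] H.in_degree_eq_sum[of u]
      by (simp add: H_verts edge_count_induce arc_count_induce sum.distrib)
  qed
  finally show ?thesis .
qed

theorem theorem8p8:
  fixes G G' :: "('a, 'e, 'b) mgraph"
    and vs :: "'a list"
    and r n n' :: nat
    and d' :: real
  assumes "simple_mixed_graph G"
    and "regular r G"
    and "distinct vs" and "set vs = verts G"
    and "n = card (verts G)"
    and "induced_submixed_graph G' G"
    and "n' = card (verts G')" and "n' < n"
    and "d' = 1 / (2 * real n') *
           (\<Sum>u\<in>verts G'. real (2 * edge_degree G' u + out_degree G' u + in_degree G' u))"
  shows "I_eigenvalue G vs (2 * n) \<le> (real n * d' - real r * real n') / (real n - real n')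
       \<and> (real n * d' - real r * real n') / (real n - real n') \<le> I_eigenvalue G vs 2"
proof -
  interpret mixed_graph G using assms(1) by (rule simple_mixed_graph.axioms)
  note vs = assms(3,4)
  have n: "length vs = n" using vs assms(5) distinct_card by metis
  obtain W where W: "W \<noteq> {}" "W \<subseteq> verts G" and G': "G' = induce G W"
    using assms(6) unfolding induced_submixed_graph_def by blast
  have G'W: "verts G' = W" by (simp add: G' induce_def)
  have n': "card W = n'" using assms(7) G'W by simp
  have "finite W" using W(2) finite_verts finite_subset by blast
  hence n'_pos: "0 < n'" using W(1) n' by (metis card_gt_0_iff)
  let ?M = "integrated_adjacency_matrix G vs"
  define x where "x = indicator_vec vs W @\<^sub>v indicator_vec vs W"
  have x: "x \<in> carrier_vec (n + n)" by (simp add: x_def flip: n)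
  have W': "W \<subseteq> set vs" using W vs by simp
  have M: "?M \<in> carrier_mat (n + n) (n + n)"
    using integrated_adjacency_matrix_carrier[of G vs] n by simp
  have ones: "x \<bullet> vec (n + n) (\<lambda>_. 1) = real (2 * n')" and norm: "x \<bullet> x = real (2 * n')"
  proof -
    have split: "vec (n + n) (\<lambda>_. 1) = vec n (\<lambda>_. 1) @\<^sub>v vec n (\<lambda>_. 1 :: real)"
      by (intro eq_vecI) auto
    have "vec (n + n) (\<lambda>_. 1) \<bullet> x = real (2 * n')"
      unfolding split x_def using scalar_prod_indicator_vec[OF vs(1) W', of "\<lambda>_. 1"]
        indicator_vec_carrier[of vs W] n n'
      by (subst scalar_prod_append[of _ n _ n]) simp_all
    thus "x \<bullet> vec (n + n) (\<lambda>_. 1) = real (2 * n')"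
      by (subst comm_scalar_prod[OF x]) simp_all
    have "indicator_vec vs W \<bullet> indicator_vec vs W = real n'"
      using scalar_prod_indicator_vec[OF vs(1) W', of "\<lambda>v. if v \<in> W then 1 else 0"] n'
      by (simp flip: indicator_vec_def)
    thus "x \<bullet> x = real (2 * n')"
      unfolding x_def by (subst scalar_prod_append[of _ n _ n]) (auto simp flip: n)
  qed
  have q: "x \<bullet> (?M *\<^sub>v x) = 2 * real n' * d'"
    unfolding x_def induced_quadratic_form[OF mixed_graph_axioms vs W] assms(9) G'W
    using n'_pos unfolding G' by simp
  \<comment> \<open>No degree grows when passing to the induced submixed graph, so the average
    degree is at most r.\<close>
  have "x \<bullet> (?M *\<^sub>v x) \<le> (\<Sum>u\<in>W. real (2 * r))"
    unfolding x_def induced_quadratic_form[OF mixed_graph_axioms vs W]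
  proof (intro sum_mono of_nat_mono)
    fix u assume "u \<in> W"
    hence "out_degree G u = in_degree G u" "edge_degree G u + out_degree G u = r"
      using assms(2) W(2) unfolding regular_def by auto
    thus "2 * edge_degree (induce G W) u + out_degree (induce G W) u + in_degree (induce G W) u
        \<le> 2 * r"
      using degrees_induce_le[of W u] by linarith
  qed
  hence le: "x \<bullet> (?M *\<^sub>v x) \<le> real r * real (2 * n')" by (simp add: n' mult_ac)
  have s: "0 < real (2 * n')" "real (2 * n') < real (n + n)" using n'_pos assms(8) by auto
  \<comment> \<open>The matrix has 2n rows and x has 2n' ones; a factor 4n' cancels.\<close>
  have num: "real (n + n) * (x \<bullet> (?M *\<^sub>v x)) - real r * (real (2 * n'))\<^sup>2
      = 4 * real n' * (real n * d' - real r * real n')"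
    and den: "real (2 * n') * (real (n + n) - real (2 * n')) = 4 * real n' * (real n - real n')"
    unfolding q by (simp_all add: algebra_simps power2_eq_square)
  have ratio: "(real (n + n) * (x \<bullet> (?M *\<^sub>v x)) - real r * (real (2 * n'))\<^sup>2)
        / (real (2 * n') * (real (n + n) - real (2 * n')))
      = (real n * d' - real r * real n') / (real n - real n')"
    unfolding num den using n'_pos by (intro mult_divide_mult_cancel_left) simp
  note bounds = constant_row_sum_rayleigh[OF M integrated_adjacency_matrix_symmetric
      regular_integrated_row_sum[OF mixed_graph_axioms assms(2) vs, unfolded n] x ones norm s le,
      unfolded ratio]
  show ?thesis using bounds by (simp add: I_eigenvalue_def mult_2)
qed

end
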